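(* Let $F$ be a field of characteristic not $2$, and let $L/F$ and $L'/F$ be elementary abelian radical quartic extensions with radical generators $\alpha\in L$, $\alpha'\in L'$ whose minimal polynomials over $F$ are $P(X)=X^4+a$ and $Q(X)=X^4+a'$ respectively. The following are equivalent: \begin{enumerate} \item $L/F$ is $F$-isomorphic to $L'/F$; \item $a'=d^4a^j$ for some $j\in\{1,3\}$ and $d\in F$; \item $a'=c^4a$ for some $c\in F$; \item for some $c\in F$, $c\alpha'$ is a radical generator (of $L'/F$) with minimal polynomial $P(X)$; \item for some $j\in\{1,3\}$ and $d\in F$, $d\alpha'^j$ is a radical generator (of $L'/F$) with minimal polynomial $P(X)$. \end{enumerate}
   Context: $F$ is a field of characteristic different from $2$. A quartic extension is elementary abelian if it is Galois with Galois group $\mathbb{Z}/2\mathbb{Z}\times\mathbb{Z}/2\mathbb{Z}$. A quartic extension is radical if it has a primitive element $\theta$ (radical generator) with $\theta^4\in F$. Two extensions of $F$ are $F$-isomorphic if there is a ring isomorphism between them fixing $F$ pointwise. *)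

theory Defs
  imports "HOL-Algebra.Algebra"
begin

text \<open>
  An extension \<open>L/F\<close> is given by two fields and a homomorphism \<open>\<iota>\<close> from \<open>F\<close> to \<open>L\<close>, so that
  different extensions of the same \<open>F\<close> may live in different types. The copy of \<open>F\<close> inside \<open>L\<close>
  is \<open>\<iota> ` carrier F\<close>.
\<close>

locale field_extension = ring_hom_cring F L \<iota> + F?: field F + L?: field L
  for F :: "('f, 'r) ring_scheme" (structure) and L :: "('l, 's) ring_scheme" (structure) and \<iota>

text \<open>The additive order \<open>group.ord\<close> is \<open>0\<close> for elements of infinite order.\<close>

definition ring_char :: "('a, 'r) ring_scheme \<Rightarrow> nat"
  where "ring_char R = group.ord (add_monoid R) \<one>\<^bsub>R\<^esub>"

definition extension_iso ::
  "('f, 'r) ring_scheme \<Rightarrow> ('l, 's) ring_scheme \<Rightarrow> ('f \<Rightarrow> 'l) \<Rightarrow> ('m, 't) ring_scheme \<Rightarrow> ('f \<Rightarrow> 'm) \<Rightarrow> bool"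
  where "extension_iso F L \<iota> L' \<iota>' \<longleftrightarrow> (\<exists>\<phi>\<in>ring_iso L L'. \<forall>x\<in>carrier F. \<phi> (\<iota> x) = \<iota>' x)"

definition Gal :: "('f, 'r) ring_scheme \<Rightarrow> ('l, 's) ring_scheme \<Rightarrow> ('f \<Rightarrow> 'l) \<Rightarrow> ('l \<Rightarrow> 'l) monoid"
  where "Gal F L \<iota> = BijGroup (carrier L)
    \<lparr>carrier := {\<sigma> \<in> Bij (carrier L). \<sigma> \<in> ring_hom L L \<and> (\<forall>x\<in>carrier F. \<sigma> (\<iota> x) = \<iota> x)}\<rparr>"

definition galois_extension :: "('f, 'r) ring_scheme \<Rightarrow> ('l, 's) ring_scheme \<Rightarrow> ('f \<Rightarrow> 'l) \<Rightarrow> bool"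
  where "galois_extension F L \<iota> \<longleftrightarrow>
    ring.finite_dimension L (\<iota> ` carrier F) (carrier L) \<and>
    {x \<in> carrier L. \<forall>\<sigma>\<in>carrier (Gal F L \<iota>). \<sigma> x = x} = \<iota> ` carrier F"

definition quartic_extension :: "('f, 'r) ring_scheme \<Rightarrow> ('l, 's) ring_scheme \<Rightarrow> ('f \<Rightarrow> 'l) \<Rightarrow> bool"
  where "quartic_extension F L \<iota> \<longleftrightarrow> ring.dimension L 4 (\<iota> ` carrier F) (carrier L)"

definition elementary_abelian_quartic ::
  "('f, 'r) ring_scheme \<Rightarrow> ('l, 's) ring_scheme \<Rightarrow> ('f \<Rightarrow> 'l) \<Rightarrow> bool"
  where "elementary_abelian_quartic F L \<iota> \<longleftrightarrow>
    quartic_extension F L \<iota> \<and> galois_extension F L \<iota> \<and>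
    Gal F L \<iota> \<cong> integer_mod_group 2 \<times>\<times> integer_mod_group 2"

definition radical_generator ::
  "('f, 'r) ring_scheme \<Rightarrow> ('l, 's) ring_scheme \<Rightarrow> ('f \<Rightarrow> 'l) \<Rightarrow> 'l \<Rightarrow> bool"
  where "radical_generator F L \<iota> \<theta> \<longleftrightarrow>
    \<theta> \<in> carrier L \<and> generate_field L (insert \<theta> (\<iota> ` carrier F)) = carrier L \<and>
    \<theta> [^]\<^bsub>L\<^esub> (4::nat) \<in> \<iota> ` carrier F"

definition radical_quartic :: "('f, 'r) ring_scheme \<Rightarrow> ('l, 's) ring_scheme \<Rightarrow> ('f \<Rightarrow> 'l) \<Rightarrow> bool"
  where "radical_quartic F L \<iota> \<longleftrightarrow> quartic_extension F L \<iota> \<and> (\<exists>\<theta>. radical_generator F L \<iota> \<theta>)"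

text \<open>
  Polynomials are coefficient lists, leading coefficient first. \<open>Irr\<close> has its coefficients in \<open>L\<close>,
  hence the transport of \<open>p\<close> along \<open>\<iota>\<close>; it is a meaningful value only for algebraic elements.
\<close>

definition is_min_poly ::
  "('f, 'r) ring_scheme \<Rightarrow> ('l, 's) ring_scheme \<Rightarrow> ('f \<Rightarrow> 'l) \<Rightarrow> 'l \<Rightarrow> 'f list \<Rightarrow> bool"
  where "is_min_poly F L \<iota> x p \<longleftrightarrow>
    x \<in> carrier L \<and> (ring.algebraic L over (\<iota> ` carrier F)) x \<and>
    p \<in> carrier (univ_poly F (carrier F)) \<and> map \<iota> p = ring.Irr L (\<iota> ` carrier F) x"

definition quartic_binomial :: "('f, 'r) ring_scheme \<Rightarrow> 'f \<Rightarrow> 'f list"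
  where "quartic_binomial F a = [\<one>\<^bsub>F\<^esub>, \<zero>\<^bsub>F\<^esub>, \<zero>\<^bsub>F\<^esub>, \<zero>\<^bsub>F\<^esub>, a]"

end

theory Submission
  imports Defs
begin

text \<open>
  Let \<open>G\<close> be the Galois group of \<open>L/F\<close> and \<open>\<alpha>\<close> a radical generator. Evaluation at \<open>\<alpha>\<close> embeds the four
  elements of \<open>G\<close> into the at most four roots \<open>\<alpha>, -\<alpha>, i\<alpha>, -i\<alpha>\<close> of \<open>X\<^sup>4 - \<alpha>\<^sup>4\<close>, so all of them are
  attained and \<open>i \<in> L\<close>. As \<open>G\<close> has exponent 2, the automorphisms with \<open>\<alpha> \<mapsto> \<plusminus>i\<alpha>\<close> negate \<open>i\<close>
  and the others fix it. Hence \<open>i\<alpha>\<^sup>2\<close> is fixed by \<open>G\<close>, so that \<open>a = -\<alpha>\<^sup>4\<close> is a square in \<open>F\<close>, which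
  makes \<open>a\<^sup>3\<close> and \<open>a\<close> differ by a fourth power. If \<open>\<beta>\<close> is another radical generator
  of \<open>L\<close>, then \<open>u = \<beta>/\<alpha>\<close> is fixed by the automorphisms fixing \<open>i\<close> and is
  multiplied by one common sign by the others; so \<open>u\<close> or \<open>iu\<close> lies in \<open>F\<close>, and in both cases
  \<open>\<beta>\<^sup>4 = c\<^sup>4 \<alpha>\<^sup>4\<close> with \<open>c \<in> F\<close>. Conversely, \<open>a' = c\<^sup>4 a\<close> makes \<open>\<alpha>'/c\<close> a root of \<open>X\<^sup>4 + a\<close>, and two
  simple extensions whose generators have the same minimal polynomial are isomorphic.
\<close>

section \<open>Kummer theory of a Klein four-group action\<close>

lemma (in monoid) nat_pow_4:
  "x \<in> carrier G \<Longrightarrow> x [^] (4::nat) = (x \<otimes> x) \<otimes> (x \<otimes> x)"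
  by (simp add: numeral_eq_Suc m_assoc)

lemma (in domain) square_eq_square:
  assumes "x \<in> carrier R" "y \<in> carrier R" "x \<otimes> x = y \<otimes> y"
  shows "x = y \<or> x = \<ominus> y"
proof -
  have "(x \<ominus> y) \<otimes> (x \<oplus> y) = x \<otimes> x \<ominus> y \<otimes> y"
    using assms(1,2) by algebra
  then have "(x \<ominus> y) \<otimes> (x \<oplus> y) = \<zero>"
    using assms by (simp add: r_right_minus_eq)
  then have "x \<ominus> y = \<zero> \<or> x \<oplus> y = \<zero>"
    using assms(1,2) integral by blast
  then show ?thesis
    using assms(1,2) minus_equality r_right_minus_eq by metis
qed

text \<open>The squares of x^2 and y^2 agree, so y^2 = x^2 or y^2 = -x^2 = (ix)^2; taking square
  roots once more leaves four values.\<close>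

lemma (in domain) fourth_power_cases:
  assumes "x \<in> carrier R" "y \<in> carrier R" "i \<in> carrier R" "i \<otimes> i = \<ominus> \<one>"
    and "y [^] (4::nat) = x [^] (4::nat)"
  shows "y \<in> {x, \<ominus> x, i \<otimes> x, \<ominus> (i \<otimes> x)}"
proof -
  have "y \<otimes> y = x \<otimes> x \<or> y \<otimes> y = \<ominus> (x \<otimes> x)"
    using assms by (intro square_eq_square) (auto simp: nat_pow_4)
  moreover have "\<ominus> (x \<otimes> x) = (i \<otimes> x) \<otimes> (i \<otimes> x)"
  proof -
    have "(i \<otimes> x) \<otimes> (i \<otimes> x) = (i \<otimes> i) \<otimes> (x \<otimes> x)" using assms(1,3) by algebra
    then show ?thesis using assms by (simp add: l_minus)
  qed
  ultimately show ?thesis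
    using square_eq_square[of y x] square_eq_square[of y "i \<otimes> x"] assms by auto
qed

text \<open>
  Only the properties of the Galois group that the Kummer argument needs: four field endomorphisms,
  closed under composition, each its own inverse.
\<close>

locale klein_action = field R for R (structure) +
  fixes G :: "('a \<Rightarrow> 'a) set"
  assumes hom: "g \<in> G \<Longrightarrow> g \<in> ring_hom R R"
    and comp: "g \<in> G \<Longrightarrow> h \<in> G \<Longrightarrow> \<exists>k\<in>G. \<forall>x\<in>carrier R. k x = g (h x)"
    and invol: "g \<in> G \<Longrightarrow> x \<in> carrier R \<Longrightarrow> g (g x) = x"
    and card_G: "card G = 4"
begin

text \<open>For a radical generator, generation of the field enters only through injectivity of
  evaluation: an automorphism is determined by its value there. Invariance of the fourth power
  stands in for membership in the base field.\<close>

definition kummer_generator :: "'a \<Rightarrow> bool"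
  where "kummer_generator \<alpha> \<longleftrightarrow> \<alpha> \<in> carrier R \<and> inj_on (\<lambda>g. g \<alpha>) G \<and>
    (\<forall>g\<in>G. g (\<alpha> [^] (4::nat)) = \<alpha> [^] (4::nat))"

lemma G_closed [simp]: "g \<in> G \<Longrightarrow> x \<in> carrier R \<Longrightarrow> g x \<in> carrier R"
  by (rule ring_hom_closed[OF hom])

lemma G_mult: "g \<in> G \<Longrightarrow> x \<in> carrier R \<Longrightarrow> y \<in> carrier R \<Longrightarrow> g (x \<otimes> y) = g x \<otimes> g y"
  by (rule ring_hom_mult[OF hom])

lemma G_minus: "g \<in> G \<Longrightarrow> x \<in> carrier R \<Longrightarrow> g (\<ominus> x) = \<ominus> (g x)"
  using ring_hom_cring.hom_a_inv[of R R g x] hom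
  by (simp add: ring_hom_cring_def ring_hom_cring_axioms_def is_cring)

lemma G_one: "g \<in> G \<Longrightarrow> g \<one> = \<one>"
  by (rule ring_hom_one[OF hom])

text \<open>Every element is an involution on the carrier, so the composite of any g with itself
  serves as identity.\<close>

lemma identity_in_G: "\<exists>e\<in>G. \<forall>x\<in>carrier R. e x = x"
proof -
  obtain g where "g \<in> G" using card_G by (metis card.empty equals0I zero_neq_numeral)
  then obtain e where "e \<in> G" "\<forall>x\<in>carrier R. e x = g (g x)" using comp by blast
  then show ?thesis using invol[OF \<open>g \<in> G\<close>] by (intro bexI[of _ e]) auto
qed

text \<open>Homomorphisms fix 0, so the orbit of 0 has one element instead of four.\<close>

lemma kummer_generator_nonzero:
  assumes "kummer_generator \<alpha>"
  shows "\<alpha> \<noteq> \<zero>"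
proof
  assume "\<alpha> = \<zero>"
  then have "(\<lambda>g. g \<alpha>) ` G \<subseteq> {\<zero>}"
    using ring_hom_zero[OF hom ring_axioms ring_axioms] by (intro image_subsetI) simp
  moreover have "card ((\<lambda>g. g \<alpha>) ` G) = 4"
    using assms card_G by (simp add: kummer_generator_def card_image)
  ultimately show False
    using card_mono[of "{\<zero>}" "(\<lambda>g. g \<alpha>) ` G"] by simp
qed

lemma kummer_conjugate_power:
  assumes "kummer_generator \<alpha>" "g \<in> G"
  shows "(g \<alpha>) [^] (4::nat) = \<alpha> [^] (4::nat)"
proof -
  have "g (\<alpha> [^] (4::nat)) = (g \<alpha>) [^] (4::nat)"
    using assms by (simp add: kummer_generator_def nat_pow_4 G_mult)
  then show ?thesis using assms unfolding kummer_generator_def by metis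
qed

text \<open>The orbit has four elements, so some conjugate y = g \<alpha> differs from \<alpha> and
  -\<alpha>. It has the same fourth power as \<alpha>, hence y^2 = -\<alpha>^2, and y/\<alpha> is
  the element sought.\<close>

lemma exists_imaginary_unit:
  assumes "kummer_generator \<alpha>"
  obtains i where "i \<in> carrier R" "i \<otimes> i = \<ominus> \<one>"
proof -
  have \<alpha>: "\<alpha> \<in> carrier R" "\<alpha> \<noteq> \<zero>"
    using assms kummer_generator_nonzero by (auto simp: kummer_generator_def)
  have "card ((\<lambda>g. g \<alpha>) ` G) = 4"
    using assms card_G by (simp add: kummer_generator_def card_image)
  moreover have "card {\<alpha>, \<ominus> \<alpha>} \<le> 2"
    by (simp add: card_insert_if)
  ultimately have "\<not> (\<lambda>g. g \<alpha>) ` G \<subseteq> {\<alpha>, \<ominus> \<alpha>}"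
    using card_mono[of "{\<alpha>, \<ominus> \<alpha>}" "(\<lambda>g. g \<alpha>) ` G"] by auto
  then obtain g where g: "g \<in> G" "g \<alpha> \<noteq> \<alpha>" "g \<alpha> \<noteq> \<ominus> \<alpha>" by auto
  define y where "y = g \<alpha>"
  have y: "y \<in> carrier R" using g \<alpha> by (simp add: y_def)
  have inv: "inv \<alpha> \<in> carrier R" "\<alpha> \<otimes> inv \<alpha> = \<one>"
    using \<alpha> field_Units by auto
  have "y \<otimes> y = \<alpha> \<otimes> \<alpha> \<or> y \<otimes> y = \<ominus> (\<alpha> \<otimes> \<alpha>)"
    using kummer_conjugate_power[OF assms g(1)] \<alpha> y
    by (intro square_eq_square) (auto simp: nat_pow_4 y_def)
  moreover have "y \<otimes> y \<noteq> \<alpha> \<otimes> \<alpha>"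
    using square_eq_square[OF y \<alpha>(1)] g unfolding y_def by blast
  ultimately have yy: "y \<otimes> y = \<ominus> (\<alpha> \<otimes> \<alpha>)" by blast
  have "(y \<otimes> inv \<alpha>) \<otimes> (y \<otimes> inv \<alpha>) = (y \<otimes> y) \<otimes> (inv \<alpha> \<otimes> inv \<alpha>)"
    using y inv(1) by algebra
  also have "\<dots> = \<ominus> ((\<alpha> \<otimes> inv \<alpha>) \<otimes> (\<alpha> \<otimes> inv \<alpha>))"
    unfolding yy using \<alpha> inv(1) by algebra
  also have "\<dots> = \<ominus> \<one>" using inv by simp
  finally show thesis using that y inv(1) by blast
qed

text \<open>Four distinct conjugates lie among four candidates, so all candidates occur and are
  pairwise distinct; \<alpha> and -\<alpha> are two of them.\<close>

lemma kummer_orbit: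
  assumes "kummer_generator \<alpha>" "i \<in> carrier R" "i \<otimes> i = \<ominus> \<one>"
  shows "(\<lambda>g. g \<alpha>) ` G = {\<alpha>, \<ominus> \<alpha>, i \<otimes> \<alpha>, \<ominus> (i \<otimes> \<alpha>)}" and "\<ominus> \<alpha> \<noteq> \<alpha>"
proof -
  have \<alpha>: "\<alpha> \<in> carrier R" using assms by (simp add: kummer_generator_def)
  have sub: "(\<lambda>g. g \<alpha>) ` G \<subseteq> {\<alpha>, \<ominus> \<alpha>, i \<otimes> \<alpha>, \<ominus> (i \<otimes> \<alpha>)}"
  proof (rule image_subsetI)
    fix g assume g: "g \<in> G"
    show "g \<alpha> \<in> {\<alpha>, \<ominus> \<alpha>, i \<otimes> \<alpha>, \<ominus> (i \<otimes> \<alpha>)}"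
      by (rule fourth_power_cases[OF \<alpha> G_closed[OF g \<alpha>] assms(2,3) kummer_conjugate_power[OF assms(1) g]])
  qed
  have card: "card ((\<lambda>g. g \<alpha>) ` G) = 4"
    using assms card_G by (simp add: kummer_generator_def card_image)
  have le: "card {\<alpha>, \<ominus> \<alpha>, i \<otimes> \<alpha>, \<ominus> (i \<otimes> \<alpha>)} \<le> 4"
    by (simp add: card_insert_if)
  then show "(\<lambda>g. g \<alpha>) ` G = {\<alpha>, \<ominus> \<alpha>, i \<otimes> \<alpha>, \<ominus> (i \<otimes> \<alpha>)}"
    using card_subset_eq[OF _ sub] card card_mono[OF _ sub] by simp
  then have "card {\<alpha>, \<ominus> \<alpha>, i \<otimes> \<alpha>, \<ominus> (i \<otimes> \<alpha>)} = 4" using card by simp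
  then show "\<ominus> \<alpha> \<noteq> \<alpha>"
    by (auto simp: card_insert_if split: if_splits)
qed

lemma kummer_eqI:
  assumes "kummer_generator \<alpha>" "g \<in> G" "h \<in> G" "g \<alpha> = h \<alpha>"
  shows "g = h"
proof -
  have "inj_on (\<lambda>g. g \<alpha>) G" using assms(1) unfolding kummer_generator_def by simp
  from inj_onD[OF this assms(4,2,3)] show ?thesis .
qed

lemma kummer_fixes_identity:
  assumes "kummer_generator \<alpha>" "g \<in> G" "g \<alpha> = \<alpha>" "x \<in> carrier R"
  shows "g x = x"
proof -
  obtain e where e: "e \<in> G" "\<forall>x\<in>carrier R. e x = x" using identity_in_G by blast
  then have "g = e" using assms by (intro kummer_eqI) (auto simp: kummer_generator_def)
  then show ?thesis using e assms by simp
qed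

text \<open>If g \<alpha> is i\<alpha> or -i\<alpha>, then g (g \<alpha>) = \<alpha> determines g i.
  Otherwise g i is found by composing g with an element that sends \<alpha> to i\<alpha>.\<close>

lemma kummer_cases:
  assumes \<alpha>: "kummer_generator \<alpha>" and i: "i \<in> carrier R" "i \<otimes> i = \<ominus> \<one>" and g: "g \<in> G"
  shows "g i = i \<and> g \<alpha> \<in> {\<alpha>, \<ominus> \<alpha>} \<or> g i = \<ominus> i \<and> g \<alpha> \<in> {i \<otimes> \<alpha>, \<ominus> (i \<otimes> \<alpha>)}"
proof -
  have \<alpha>c: "\<alpha> \<in> carrier R" and nz: "\<alpha> \<noteq> \<zero>"
    using \<alpha> kummer_generator_nonzero by (auto simp: kummer_generator_def)
  have neg: "h i = \<ominus> i" if h: "h \<in> G" "h \<alpha> \<in> {i \<otimes> \<alpha>, \<ominus> (i \<otimes> \<alpha>)}" for h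
  proof -
    have hi: "h i \<in> carrier R" using h i by simp
    \<comment> \<open>The sign in h \<alpha> enters twice and cancels.\<close>
    have "h (h \<alpha>) = (h i \<otimes> i) \<otimes> \<alpha>"
    proof (cases "h \<alpha> = i \<otimes> \<alpha>")
      case True
      then show ?thesis using h i \<alpha>c hi by (simp add: G_mult m_assoc)
    next
      case False
      then have *: "h \<alpha> = \<ominus> (i \<otimes> \<alpha>)" using h by simp
      then have "h (h \<alpha>) = \<ominus> (h i \<otimes> (\<ominus> (i \<otimes> \<alpha>)))"
        using h i \<alpha>c hi by (simp add: G_mult G_minus)
      also have "\<dots> = (h i \<otimes> i) \<otimes> \<alpha>" using i \<alpha>c hi by algebra
      finally show ?thesis .
    qed
    then have "(h i \<otimes> i) \<otimes> \<alpha> = \<one> \<otimes> \<alpha>" using invol[OF h(1) \<alpha>c] \<alpha>c by simp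
    then have "h i \<otimes> i = \<one>" using \<alpha>c nz hi i m_rcancel by (metis m_closed one_closed)
    \<comment> \<open>Multiplying h i * i = 1 by -i turns it into h i = -i.\<close>
    moreover have "\<ominus> ((h i \<otimes> i) \<otimes> i) = \<ominus> (h i \<otimes> (i \<otimes> i))" using i(1) hi by algebra
    ultimately show ?thesis using i hi by (simp add: r_minus)
  qed
  have "g i = i" if "g \<alpha> \<in> {\<alpha>, \<ominus> \<alpha>}"
  proof (cases "g \<alpha> = \<alpha>")
    case True
    then show ?thesis using kummer_fixes_identity[OF \<alpha> g] i(1) by simp
  next
    case False
    then have s: "g \<alpha> = \<ominus> \<alpha>" using that by simp
    have "g i \<otimes> g i = \<ominus> \<one>"
      using G_mult[OF g i(1,1)] i(2) G_minus[OF g one_closed] G_one[OF g] by simp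
    then have "g i = i \<or> g i = \<ominus> i"
      using square_eq_square[of "g i" i] g i by simp
    moreover have "g i \<noteq> \<ominus> i"
    proof
      assume si: "g i = \<ominus> i"
      \<comment> \<open>Take k with k \<alpha> = i\<alpha>. If g negates both i and \<alpha>, the
        composite of g after k sends \<alpha> to (-i)(-\<alpha>) = k \<alpha>, so it equals k.
        Evaluating at k \<alpha>, which k sends back to \<alpha>, shows that g fixes
        \<alpha>.\<close>
      have "i \<otimes> \<alpha> \<in> (\<lambda>g. g \<alpha>) ` G" unfolding kummer_orbit(1)[OF \<alpha> i] by simp
      then obtain k where k: "k \<in> G" "k \<alpha> = i \<otimes> \<alpha>" by (elim imageE) simp
      obtain h where h: "h \<in> G" "\<forall>x\<in>carrier R. h x = g (k x)"
        using comp[OF g k(1)] by blast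
      have "h \<alpha> = \<ominus> i \<otimes> \<ominus> \<alpha>" using h k \<alpha>c s si i g by (simp add: G_mult)
      also have "\<dots> = k \<alpha>" unfolding k(2) using i \<alpha>c by algebra
      finally have "h = k" by (rule kummer_eqI[OF \<alpha> h(1) k(1)])
      then have "g \<alpha> = \<alpha>" using h(2) \<alpha>c invol[OF k(1) \<alpha>c] G_closed[OF k(1) \<alpha>c] by metis
      then show False using False by simp
    qed
    ultimately show ?thesis by blast
  qed
  moreover have "g \<alpha> \<in> {\<alpha>, \<ominus> \<alpha>, i \<otimes> \<alpha>, \<ominus> (i \<otimes> \<alpha>)}"
    using imageI[OF g, of "\<lambda>g. g \<alpha>"] unfolding kummer_orbit(1)[OF \<alpha> i] .
  ultimately show ?thesis using neg[OF g] by blast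
qed

text \<open>The witness is i\<alpha>^2, whose square is -\<alpha>^4: an element of G either fixes
  both i and \<alpha>^2 or negates both.\<close>

lemma minus_kummer_power_is_fixed_square:
  assumes \<alpha>: "kummer_generator \<alpha>"
  obtains b where "b \<in> carrier R" "\<forall>g\<in>G. g b = b" "\<ominus> (\<alpha> [^] (4::nat)) = b \<otimes> b"
proof -
  obtain i where i: "i \<in> carrier R" "i \<otimes> i = \<ominus> \<one>" using exists_imaginary_unit[OF \<alpha>] .
  have \<alpha>c: "\<alpha> \<in> carrier R" using \<alpha> by (simp add: kummer_generator_def)
  have fixed: "g (i \<otimes> (\<alpha> \<otimes> \<alpha>)) = i \<otimes> (\<alpha> \<otimes> \<alpha>)" if g: "g \<in> G" for g
  proof -
    have *: "g (i \<otimes> (\<alpha> \<otimes> \<alpha>)) = g i \<otimes> (g \<alpha> \<otimes> g \<alpha>)"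
      using g i \<alpha>c by (simp add: G_mult)
    have minus_sq: "\<ominus> x \<otimes> \<ominus> x = x \<otimes> x" if "x \<in> carrier R" for x
      using that by algebra
    have "\<ominus> i \<otimes> ((i \<otimes> \<alpha>) \<otimes> (i \<otimes> \<alpha>)) = \<ominus> (i \<otimes> i) \<otimes> (i \<otimes> (\<alpha> \<otimes> \<alpha>))"
      using i(1) \<alpha>c by algebra
    then have "\<ominus> i \<otimes> ((i \<otimes> \<alpha>) \<otimes> (i \<otimes> \<alpha>)) = i \<otimes> (\<alpha> \<otimes> \<alpha>)"
      using i \<alpha>c by simp
    then show ?thesis
      using kummer_cases[OF \<alpha> i g] i \<alpha>c minus_sq by (auto simp: *)
  qed
  have "(i \<otimes> (\<alpha> \<otimes> \<alpha>)) \<otimes> (i \<otimes> (\<alpha> \<otimes> \<alpha>)) = (i \<otimes> i) \<otimes> ((\<alpha> \<otimes> \<alpha>) \<otimes> (\<alpha> \<otimes> \<alpha>))"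
    using i(1) \<alpha>c by algebra
  then have "\<ominus> (\<alpha> [^] (4::nat)) = (i \<otimes> (\<alpha> \<otimes> \<alpha>)) \<otimes> (i \<otimes> (\<alpha> \<otimes> \<alpha>))"
    using i \<alpha>c by (simp add: nat_pow_4 l_minus)
  then show thesis using that[of "i \<otimes> (\<alpha> \<otimes> \<alpha>)"] fixed i(1) \<alpha>c by simp
qed

text \<open>Put u = \<beta>/\<alpha>. Either all of G fixes u and c = u works, or every element
  negating i also negates u, so that c = iu is fixed; since i^4 = 1, the fourth power is the
  same.\<close>

lemma kummer_generators_ratio:
  assumes \<alpha>: "kummer_generator \<alpha>" and \<beta>: "kummer_generator \<beta>"
  obtains c where "c \<in> carrier R" "\<forall>g\<in>G. g c = c"
    "\<beta> [^] (4::nat) = c [^] (4::nat) \<otimes> \<alpha> [^] (4::nat)"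
proof -
  obtain i where i: "i \<in> carrier R" "i \<otimes> i = \<ominus> \<one>" using exists_imaginary_unit[OF \<alpha>] .
  have \<alpha>c: "\<alpha> \<in> carrier R" "\<alpha> \<noteq> \<zero>" and \<beta>c: "\<beta> \<in> carrier R" "\<beta> \<noteq> \<zero>"
    using \<alpha> \<beta> kummer_generator_nonzero by (auto simp: kummer_generator_def)
  have inz: "i \<noteq> \<zero>"
    using i by (metis integral_iff add.inv_eq_1_iff one_closed zero_closed one_not_zero)
  define u where "u = \<beta> \<otimes> inv \<alpha>"
  have inv: "inv \<alpha> \<in> carrier R" "inv \<alpha> \<otimes> \<alpha> = \<one>"
    using \<alpha>c field_Units by auto
  have u: "u \<in> carrier R" using inv \<beta>c by (simp add: u_def)
  have \<beta>u: "\<beta> = u \<otimes> \<alpha>" using inv \<alpha>c \<beta>c by (simp add: u_def m_assoc)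
  have g\<beta>: "g \<beta> = g u \<otimes> g \<alpha>" if "g \<in> G" for g
    using that u \<alpha>c by (simp add: \<beta>u G_mult)
  \<comment> \<open>A g that fixes i but neither \<alpha> nor \<beta> negates both, and the signs
    cancel in the quotient; \<open>ii\<close> excludes the case of \<open>kummer_cases\<close> in
    which i is negated.\<close>
  have fixed: "g u = u" if g: "g \<in> G" and gi: "g i = i" for g
  proof -
    have ii: "\<ominus> i \<noteq> i"
    proof
      assume "\<ominus> i = i"
      then have "\<ominus> (i \<otimes> \<alpha>) = i \<otimes> \<alpha>" using i \<alpha>c by (simp add: l_minus[symmetric])
      then have "i \<otimes> \<ominus> \<alpha> = i \<otimes> \<alpha>" using i \<alpha>c by (simp add: r_minus)
      then have "\<ominus> \<alpha> = \<alpha>" using i inz \<alpha>c m_lcancel by (metis a_inv_closed)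
      then show False using kummer_orbit(2)[OF \<alpha> i] by simp
    qed
    show ?thesis
    proof (cases "g \<alpha> = \<alpha> \<or> g \<beta> = \<beta>")
      case True
      then show ?thesis using kummer_fixes_identity[OF \<alpha> g _ u] kummer_fixes_identity[OF \<beta> g _ u] by blast
    next
      case False
      then have "g \<alpha> = \<ominus> \<alpha>" "g \<beta> = \<ominus> \<beta>"
        using kummer_cases[OF \<alpha> i g] kummer_cases[OF \<beta> i g] ii gi by auto
      then have "g u \<otimes> \<ominus> \<alpha> = u \<otimes> \<ominus> \<alpha>"
        using g\<beta>[OF g] \<beta>u u \<alpha>c by (simp add: r_minus)
      then show ?thesis
        using u g \<alpha>c m_rcancel[of "\<ominus> \<alpha>" "g u" u] by auto
    qed
  qed
  \<comment> \<open>An element moving i multiplies both \<alpha> and \<beta> by i up to sign, so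
    both squares acquire the same factor and u^2 stays fixed.\<close>
  have sign: "g u = u \<or> g u = \<ominus> u" if g: "g \<in> G" for g
  proof (cases "g i = i")
    case True
    then show ?thesis using fixed[OF g] by blast
  next
    case False
    then have *: "g \<alpha> \<in> {i \<otimes> \<alpha>, \<ominus> (i \<otimes> \<alpha>)}" "g \<beta> \<in> {i \<otimes> \<beta>, \<ominus> (i \<otimes> \<beta>)}"
      using kummer_cases[OF \<alpha> i g] kummer_cases[OF \<beta> i g] by auto
    have gu: "g u \<in> carrier R" using g u by simp
    have "g \<beta> \<otimes> g \<beta> = (i \<otimes> \<beta>) \<otimes> (i \<otimes> \<beta>)"
      using * i \<beta>c by (auto simp: l_minus r_minus)
    also have "\<dots> = (u \<otimes> u) \<otimes> ((i \<otimes> \<alpha>) \<otimes> (i \<otimes> \<alpha>))"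
      unfolding \<beta>u using i(1) u \<alpha>c(1) by algebra
    also have "(i \<otimes> \<alpha>) \<otimes> (i \<otimes> \<alpha>) = g \<alpha> \<otimes> g \<alpha>"
      using * i \<alpha>c by (auto simp: l_minus r_minus)
    finally have "(g u \<otimes> g u) \<otimes> (g \<alpha> \<otimes> g \<alpha>) = (u \<otimes> u) \<otimes> (g \<alpha> \<otimes> g \<alpha>)"
      unfolding g\<beta>[OF g] using gu \<alpha>c g by (simp add: m_ac)
    moreover have "g \<alpha> \<noteq> \<zero>" using * i inz \<alpha>c by (auto simp: integral_iff)
    ultimately have "g u \<otimes> g u = u \<otimes> u"
      using gu u g \<alpha>c m_rcancel[of "g \<alpha> \<otimes> g \<alpha>" "g u \<otimes> g u" "u \<otimes> u"] by (simp add: integral_iff)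
    then show ?thesis using square_eq_square[OF gu u] by blast
  qed
  have \<beta>4: "\<beta> [^] (4::nat) = u [^] (4::nat) \<otimes> \<alpha> [^] (4::nat)"
    unfolding \<beta>u using u \<alpha>c by (simp add: nat_pow_distrib)
  show thesis
  proof (cases "\<forall>g\<in>G. g u = u")
    case True
    then show thesis using that[of u] u \<beta>4 by simp
  next
    case False
    then obtain g where g: "g \<in> G" "g u \<noteq> u" by blast
    \<comment> \<open>Let g move u. If k negates i but fixes u, then g after k fixes i, hence u,
      although g (k u) = g u differs from u.\<close>
    have neg: "k u = \<ominus> u" if k: "k \<in> G" "k i = \<ominus> i" for k
    proof (rule ccontr)
      assume "k u \<noteq> \<ominus> u"
      then have ku: "k u = u" using sign[OF k(1)] by blast
      have gi: "g i = \<ominus> i" using fixed[OF g(1)] g(2) kummer_cases[OF \<alpha> i g(1)] by blast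
      obtain h where h: "h \<in> G" "\<forall>x\<in>carrier R. h x = g (k x)"
        using comp[OF g(1) k(1)] by blast
      have "h i = i" using h k g gi i by (simp add: G_minus)
      then have "h u = u" using fixed[OF h(1)] by blast
      then show False using h u ku g by simp
    qed
    have "k (i \<otimes> u) = i \<otimes> u" if k: "k \<in> G" for k
    proof (cases "k i = i")
      case True
      then show ?thesis using fixed[OF k] k i u by (simp add: G_mult)
    next
      case False
      then have "k i = \<ominus> i" using kummer_cases[OF \<alpha> i k] by blast
      then show ?thesis using neg[OF k] k i u by (simp add: G_mult l_minus r_minus)
    qed
    moreover have "(i \<otimes> u) [^] (4::nat) = u [^] (4::nat)"
    proof -
      have "i [^] (4::nat) = \<one>" using i by (simp add: nat_pow_4 l_minus)
      then show ?thesis using i u by (simp add: nat_pow_distrib)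
    qed
    ultimately show thesis using that[of "i \<otimes> u"] i u \<beta>4 by simp
  qed
qed

end

section \<open>Simple extensions and minimal polynomials\<close>

context field_extension
begin

abbreviation base :: "'l set" where "base \<equiv> \<iota> ` carrier F"

lemma inj_embedding: "inj_on \<iota> (carrier F)"
  using ring.img_is_subfield(1)[OF F.carrier_is_subfield] L.one_not_zero by blast

lemma base_subfield: "subfield base L"
  using ring.img_is_subfield(2)[OF F.carrier_is_subfield] L.one_not_zero by blast

lemma embedding_eq_iff [simp]:
  "x \<in> carrier F \<Longrightarrow> y \<in> carrier F \<Longrightarrow> \<iota> x = \<iota> y \<longleftrightarrow> x = y"
  using inj_embedding by (auto dest: inj_onD)

lemma embedding_eq_zero_iff [simp]:
  "x \<in> carrier F \<Longrightarrow> \<iota> x = \<zero>\<^bsub>L\<^esub> \<longleftrightarrow> x = \<zero>\<^bsub>F\<^esub>"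
  using embedding_eq_iff[of x "\<zero>\<^bsub>F\<^esub>"] by simp

lemma minus_embedding_eq_iff:
  assumes "x \<in> carrier F" "y \<in> carrier F"
  shows "\<ominus>\<^bsub>L\<^esub> \<iota> x = \<ominus>\<^bsub>L\<^esub> \<iota> y \<longleftrightarrow> x = y"
  using assms S.minus_minus[of "\<iota> x"] S.minus_minus[of "\<iota> y"] embedding_eq_iff by (metis hom_closed)

lemma map_embedding_poly:
  assumes "p \<in> carrier (univ_poly F (carrier F))"
  shows "map \<iota> p \<in> carrier (univ_poly L base)"
  using assms unfolding univ_poly_carrier[symmetric] polynomial_def
  by (auto simp: hd_map subset_iff)

lemma base_poly_is_map:
  assumes "q \<in> carrier (univ_poly L base)"
  shows "\<exists>p\<in>carrier (univ_poly F (carrier F)). map \<iota> p = q"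
proof -
  define p where "p = map (inv_into (carrier F) \<iota>) q"
  have set: "set q \<subseteq> base" and hd: "q \<noteq> [] \<Longrightarrow> hd q \<noteq> \<zero>\<^bsub>L\<^esub>"
    using assms unfolding univ_poly_carrier[symmetric] polynomial_def by auto
  have p: "map \<iota> p = q"
    unfolding p_def using set by (auto simp: f_inv_into_f intro!: map_idI)
  moreover have "set p \<subseteq> carrier F"
    unfolding p_def using set by (auto intro!: inv_into_into)
  moreover have "p \<noteq> [] \<Longrightarrow> hd p \<noteq> \<zero>\<^bsub>F\<^esub>"
    using hd p by (metis hd_map hom_zero list.map_disc_iff)
  ultimately have "p \<in> carrier (univ_poly F (carrier F))"
    unfolding univ_poly_carrier[symmetric] polynomial_def by blast
  then show ?thesis using p by blast
qed

lemma eval_map_hom: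
  assumes x: "x \<in> carrier L"
  shows "(\<lambda>p. S.eval (map \<iota> p) x) \<in> ring_hom (univ_poly F (carrier F)) L"
proof (rule ring_hom_memI)
  have set: "set p \<subseteq> carrier F" "set (map \<iota> p) \<subseteq> carrier L"
    if "p \<in> carrier (univ_poly F (carrier F))" for p
    using that unfolding univ_poly_carrier[symmetric] polynomial_def by auto
  fix p q assume pq: "p \<in> carrier (univ_poly F (carrier F))" "q \<in> carrier (univ_poly F (carrier F))"
  note s = set[OF pq(1)] set[OF pq(2)]
  have add: "set (map \<iota> (R.poly_add p q)) \<subseteq> carrier L" and
    mult: "set (map \<iota> (R.poly_mult p q)) \<subseteq> carrier L"
    using R.poly_add_in_carrier[OF s(1,3)] R.poly_mult_in_carrier[OF s(1,3)] by auto
  show "S.eval (map \<iota> p) x \<in> carrier L" using S.eval_in_carrier[OF s(2) x] .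
  \<comment> \<open>Mapping a sum or product gives the sum or product of the images only up to
    normalization, which evaluation ignores.\<close>
  show "S.eval (map \<iota> (p \<oplus>\<^bsub>univ_poly F (carrier F)\<^esub> q)) x = S.eval (map \<iota> p) x \<oplus>\<^bsub>L\<^esub> S.eval (map \<iota> q) x"
    unfolding univ_poly_add
    using S.eval_normalize[OF add x] S.eval_poly_add[OF s(2,4) x] ring.poly_add_hom'[OF s(1,3)] by metis
  show "S.eval (map \<iota> (p \<otimes>\<^bsub>univ_poly F (carrier F)\<^esub> q)) x = S.eval (map \<iota> p) x \<otimes>\<^bsub>L\<^esub> S.eval (map \<iota> q) x"
    unfolding univ_poly_mult
    using S.eval_normalize[OF mult x] S.eval_poly_mult[OF s(2,4) x] ring.poly_mult_hom'[OF s(1,3)] by metis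
next
  show "S.eval (map \<iota> \<one>\<^bsub>univ_poly F (carrier F)\<^esub>) x = \<one>\<^bsub>L\<^esub>"
    using x by (simp add: univ_poly_one)
qed

text \<open>For algebraic x, the polynomial expressions in x already form a field, so closing under
  inverses adds nothing.\<close>

lemma simple_extension_eq_generate_field:
  assumes "x \<in> carrier L" "(S.algebraic over base) x"
  shows "S.simple_extension base x = generate_field L (insert x base)"
proof
  have sub: "insert x base \<subseteq> carrier L" using assms by auto
  note gen = L.generate_field_is_subfield[OF sub]
  show "S.simple_extension base x \<subseteq> generate_field L (insert x base)"
    using S.simple_extension_subring_incl[OF subfieldE(1)[OF gen], of base x]
      generate_field.incl[of _ "insert x base" L] by auto
  have "subfield (S.simple_extension base x) L"
    using L.simple_extension_is_subfield[OF base_subfield assms(1)] assms(2) by simp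
  moreover have "insert x base \<subseteq> S.simple_extension base x"
    using S.simple_extension_mem[OF subfieldE(1)[OF base_subfield] assms(1)]
      S.simple_extension_incl[OF subfieldE(3)[OF base_subfield] assms(1)] by auto
  ultimately show "generate_field L (insert x base) \<subseteq> S.simple_extension base x"
    using L.generate_field_min_subfield1[OF sub] by blast
qed

text \<open>\<open>Irr\<close> divides every annihilating polynomial, so a nonzero one has at least
  its degree.\<close>

lemma low_degree_annihilator_zero:
  assumes "x \<in> carrier L" "(S.algebraic over base) x"
    and "q \<in> carrier (univ_poly L base)" "S.eval q x = \<zero>\<^bsub>L\<^esub>"
    and "length q < length (S.Irr base x)"
  shows "q = []"
proof (rule ccontr)
  assume "q \<noteq> []"
  then have "length (S.Irr base x) - 1 \<le> length q - 1"
    using L.pdivides_imp_degree_le[OF subfieldE(1)[OF base_subfield]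
        L.IrrE(1)[OF base_subfield assms(1,2)] assms(3)]
      L.Irr_minimal[OF base_subfield assms(1-4)] by blast
  \<comment> \<open>Degrees are truncated differences; the bound on the length of q makes the
    comparison of degrees one of lengths.\<close>
  moreover have "length q \<ge> 1" using \<open>q \<noteq> []\<close> by (cases q) auto
  ultimately show False using assms(5) by linarith
qed

lemma is_min_polyD:
  assumes "is_min_poly F L \<iota> x p"
  shows "x \<in> carrier L" "(S.algebraic over base) x" "p \<in> carrier (univ_poly F (carrier F))"
    "map \<iota> p = S.Irr base x" "S.eval (map \<iota> p) x = \<zero>\<^bsub>L\<^esub>" "p \<noteq> []"
proof -
  show *: "x \<in> carrier L" "(S.algebraic over base) x" "p \<in> carrier (univ_poly F (carrier F))"
    "map \<iota> p = S.Irr base x" using assms unfolding is_min_poly_def by auto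
  note irr = L.IrrE[OF base_subfield *(1,2)]
  show "S.eval (map \<iota> p) x = \<zero>\<^bsub>L\<^esub>" using irr *(4) by simp
  have "S.Irr base x \<noteq> []"
    using S.pirreducible_degree[OF base_subfield irr(1,2)] by auto
  then show "p \<noteq> []" using *(4) by auto
qed

text \<open>Each element of the generated field is a polynomial expression in x over the base, and
  each such polynomial comes from F.\<close>

lemma eval_map_surj:
  assumes "x \<in> carrier L" "(S.algebraic over base) x"
    and "generate_field L (insert x base) = carrier L"
  shows "(\<lambda>p. S.eval (map \<iota> p) x) ` carrier (univ_poly F (carrier F)) = carrier L"
proof -
  have "carrier L = (\<lambda>p. S.eval p x) ` carrier (univ_poly L base)"
    using simple_extension_eq_generate_field[OF assms(1,2)] assms(3)
      S.simple_extension_as_eval_img[OF subfieldE(3)[OF base_subfield] assms(1)] by simp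
  also have "carrier (univ_poly L base) = map \<iota> ` carrier (univ_poly F (carrier F))"
    using map_embedding_poly base_poly_is_map by blast
  finally show ?thesis by (simp add: image_image)
qed

text \<open>The kernel of evaluation is the ideal generated by p, which depends on F and p alone;
  this makes different extensions comparable. The remainder after division by p annihilates x and
  has too small a degree to be nonzero.\<close>

lemma eval_map_zero_iff:
  assumes min: "is_min_poly F L \<iota> x p" and q: "q \<in> carrier (univ_poly F (carrier F))"
  shows "S.eval (map \<iota> q) x = \<zero>\<^bsub>L\<^esub> \<longleftrightarrow> (\<exists>s\<in>carrier (univ_poly F (carrier F)). q = p \<otimes>\<^bsub>univ_poly F (carrier F)\<^esub> s)"
proof -
  let ?P = "univ_poly F (carrier F)"
  note D = is_min_polyD[OF min]
  interpret P: domain ?P using F.univ_poly_is_domain[OF R.carrier_is_subring] .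
  have hom: "(\<lambda>p. S.eval (map \<iota> p) x) \<in> ring_hom ?P L" using eval_map_hom[OF D(1)] .
  note hom_add = ring_hom_add[OF hom] and hom_mult = ring_hom_mult[OF hom] and hom_closed = ring_hom_closed[OF hom]
  show ?thesis
  proof
    assume z: "S.eval (map \<iota> q) x = \<zero>\<^bsub>L\<^esub>"
    obtain s r where sr: "s \<in> carrier ?P" "r \<in> carrier ?P" "q = p \<otimes>\<^bsub>?P\<^esub> s \<oplus>\<^bsub>?P\<^esub> r"
      "r = \<zero>\<^bsub>?P\<^esub> \<or> length r - 1 < length p - 1"
      using F.field_long_division_theorem_shell[OF F.carrier_is_subfield q D(3)] D(6)
      by (auto simp: univ_poly_zero)
    have "S.eval (map \<iota> q) x = S.eval (map \<iota> p) x \<otimes>\<^bsub>L\<^esub> S.eval (map \<iota> s) x \<oplus>\<^bsub>L\<^esub> S.eval (map \<iota> r) x"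
      unfolding sr(3) using sr(1,2) D(3) by (simp add: hom_add hom_mult)
    then have "S.eval (map \<iota> r) x = \<zero>\<^bsub>L\<^esub>"
      using z D(5) hom_closed[OF sr(1)] hom_closed[OF sr(2)] by simp
    moreover have "length r < length p" using sr(4) D(6) by (cases p) (auto simp: univ_poly_zero)
    ultimately have "map \<iota> r = []"
      using low_degree_annihilator_zero[OF D(1,2) map_embedding_poly[OF sr(2)]] D(4)[symmetric] by simp
    then have "q = p \<otimes>\<^bsub>?P\<^esub> s" using sr D(3) by (simp add: univ_poly_zero[symmetric])
    then show "\<exists>s\<in>carrier ?P. q = p \<otimes>\<^bsub>?P\<^esub> s" using sr(1) by blast
  next
    assume "\<exists>s\<in>carrier ?P. q = p \<otimes>\<^bsub>?P\<^esub> s"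
    then obtain s where s: "s \<in> carrier ?P" "q = p \<otimes>\<^bsub>?P\<^esub> s" by blast
    show "S.eval (map \<iota> q) x = \<zero>\<^bsub>L\<^esub>"
      unfolding s(2) using hom_mult[OF D(3) s(1)] D(5) hom_closed[OF s(1)] by simp
  qed
qed

end

section \<open>Isomorphism of simple extensions with a common minimal polynomial\<close>

lemma ring_iso_of_same_kernel:
  assumes "ring P" "ring L" "ring L'"
    and f: "f \<in> ring_hom P L" "f ` carrier P = carrier L"
    and g: "g \<in> ring_hom P L'" "g ` carrier P = carrier L'"
    and ker: "\<And>p. p \<in> carrier P \<Longrightarrow> f p = \<zero>\<^bsub>L\<^esub> \<longleftrightarrow> g p = \<zero>\<^bsub>L'\<^esub>"
  obtains \<phi> where "\<phi> \<in> ring_iso L L'" "\<And>p. p \<in> carrier P \<Longrightarrow> \<phi> (f p) = g p"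
proof -
  interpret P: ring P by fact
  interpret f: ring_hom_ring P L f using assms by (intro ring_hom_ringI2)
  interpret g: ring_hom_ring P L' g using assms by (intro ring_hom_ringI2)
  have eq: "f p = f q \<longleftrightarrow> g p = g q" if "p \<in> carrier P" "q \<in> carrier P" for p q
  proof -
    have "f (p \<ominus>\<^bsub>P\<^esub> q) = f p \<ominus>\<^bsub>L\<^esub> f q" "g (p \<ominus>\<^bsub>P\<^esub> q) = g p \<ominus>\<^bsub>L'\<^esub> g q"
      using that by (simp_all add: a_minus_def)
    then show ?thesis using ker[of "p \<ominus>\<^bsub>P\<^esub> q"] that by simp
  qed
  \<comment> \<open>The choice of preimage is harmless: by \<open>eq\<close>, all preimages of an
    element under f have the same image under g.\<close>
  define \<phi> where "\<phi> = (\<lambda>y. g (inv_into (carrier P) f y))"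
  have \<phi>: "\<phi> (f p) = g p" if "p \<in> carrier P" for p
    unfolding \<phi>_def using that eq[of "inv_into (carrier P) f (f p)" p]
    by (simp add: f_inv_into_f inv_into_into)
  have rep: "\<exists>p\<in>carrier P. y = f p" if "y \<in> carrier L" for y
    using that f(2) by blast
  have "\<phi> \<in> ring_hom L L'"
  proof (rule ring_hom_memI)
    fix x y assume "x \<in> carrier L" "y \<in> carrier L"
    then obtain p q where pq: "p \<in> carrier P" "q \<in> carrier P" "x = f p" "y = f q"
      using rep by meson
    show "\<phi> x \<in> carrier L'" using pq \<phi> by simp
    show "\<phi> (x \<otimes>\<^bsub>L\<^esub> y) = \<phi> x \<otimes>\<^bsub>L'\<^esub> \<phi> y"
      using pq \<phi>[of "p \<otimes>\<^bsub>P\<^esub> q"] \<phi> by simp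
    show "\<phi> (x \<oplus>\<^bsub>L\<^esub> y) = \<phi> x \<oplus>\<^bsub>L'\<^esub> \<phi> y"
      using pq \<phi>[of "p \<oplus>\<^bsub>P\<^esub> q"] \<phi> by simp
  next
    show "\<phi> \<one>\<^bsub>L\<^esub> = \<one>\<^bsub>L'\<^esub>" using \<phi>[of "\<one>\<^bsub>P\<^esub>"] by simp
  qed
  moreover have "inj_on \<phi> (carrier L)"
  proof (rule inj_onI)
    fix x y assume "x \<in> carrier L" "y \<in> carrier L" and e: "\<phi> x = \<phi> y"
    then obtain p q where pq: "p \<in> carrier P" "q \<in> carrier P" "x = f p" "y = f q"
      using rep by meson
    then show "x = y" using e eq \<phi> by simp
  qed
  moreover have "\<phi> ` carrier L = carrier L'"
    using \<phi> by (simp add: f(2)[symmetric] g(2)[symmetric] image_image)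
  ultimately have "\<phi> \<in> ring_iso L L'" by (simp add: ring_iso_def bij_betw_def)
  then show thesis using that \<phi> by blast
qed

text \<open>Evaluation at x and evaluation at y map F[X] onto the two fields with the same kernel,
  generated by p. Constants evaluate to their embedded copies, so the induced isomorphism respects
  F.\<close>

lemma extension_iso_of_common_min_poly:
  assumes "field_extension F L \<iota>" "field_extension F L' \<iota>'"
    and x: "is_min_poly F L \<iota> x p" "generate_field L (insert x (\<iota> ` carrier F)) = carrier L"
    and y: "is_min_poly F L' \<iota>' y p" "generate_field L' (insert y (\<iota>' ` carrier F)) = carrier L'"
  shows "extension_iso F L \<iota> L' \<iota>'"
proof -
  interpret E: field_extension F L \<iota> by fact
  interpret E': field_extension F L' \<iota>' by fact
  let ?P = "univ_poly F (carrier F)"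
  note D = E.is_min_polyD[OF x(1)] and D' = E'.is_min_polyD[OF y(1)]
  obtain \<phi> where \<phi>: "\<phi> \<in> ring_iso L L'"
    "\<And>q. q \<in> carrier ?P \<Longrightarrow> \<phi> (E.S.eval (map \<iota> q) x) = E'.S.eval (map \<iota>' q) y"
    using ring_iso_of_same_kernel[OF E.F.univ_poly_is_ring[OF E.R.carrier_is_subring]
        E.S.ring_axioms E'.S.ring_axioms
        E.eval_map_hom[OF D(1)] E.eval_map_surj[OF D(1,2) x(2)]
        E'.eval_map_hom[OF D'(1)] E'.eval_map_surj[OF D'(1,2) y(2)]]
      E.eval_map_zero_iff[OF x(1)] E'.eval_map_zero_iff[OF y(1)] by auto
  \<comment> \<open>The zero constant is the empty list rather than a one-entry list, hence the case
    distinction.\<close>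
  have "\<phi> (\<iota> c) = \<iota>' c" if c: "c \<in> carrier F" for c
  proof (cases "c = \<zero>\<^bsub>F\<^esub>")
    case True
    then show ?thesis using \<phi>(2)[of "[]"] by (simp add: univ_poly_zero_closed)
  next
    case False
    then have "[c] \<in> carrier ?P"
      using c unfolding univ_poly_carrier[symmetric] polynomial_def by simp
    then show ?thesis using \<phi>(2)[of "[c]"] c D(1) D'(1) by simp
  qed
  then show ?thesis using \<phi>(1) unfolding extension_iso_def by blast
qed

context field_extension
begin

subsection \<open>Radical generators\<close>

lemma eval_quartic_binomial:
  assumes "a \<in> carrier F" "x \<in> carrier L"
  shows "S.eval (map \<iota> (quartic_binomial F a)) x = x [^]\<^bsub>L\<^esub> (4::nat) \<oplus>\<^bsub>L\<^esub> \<iota> a"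
  using assms by (simp add: quartic_binomial_def numeral_eq_Suc)

lemma fourth_power_of_min_poly:
  assumes "a \<in> carrier F" "is_min_poly F L \<iota> x (quartic_binomial F a)"
  shows "x [^]\<^bsub>L\<^esub> (4::nat) = \<ominus>\<^bsub>L\<^esub> \<iota> a"
proof -
  note D = is_min_polyD[OF assms(2)]
  have "x [^]\<^bsub>L\<^esub> (4::nat) \<oplus>\<^bsub>L\<^esub> \<iota> a = \<zero>\<^bsub>L\<^esub>"
    using eval_quartic_binomial[OF assms(1) D(1)] D(5) by simp
  then show ?thesis using S.minus_equality[of "x [^]\<^bsub>L\<^esub> (4::nat)" "\<iota> a"] assms(1) D(1) by simp
qed

text \<open>\<open>Irr\<close> is monic, and its degree is the dimension 4. Its difference from X^4
  + a annihilates x and has degree at most 3, so it vanishes.\<close>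

lemma min_poly_of_radical_generator:
  assumes quartic: "quartic_extension F L \<iota>" and rad: "radical_generator F L \<iota> x"
    and a: "a \<in> carrier F" and pow: "x [^]\<^bsub>L\<^esub> (4::nat) = \<ominus>\<^bsub>L\<^esub> \<iota> a"
  shows "is_min_poly F L \<iota> x (quartic_binomial F a)"
proof -
  have x: "x \<in> carrier L" and gen: "generate_field L (insert x base) = carrier L"
    using rad unfolding radical_generator_def by auto
  have dim: "S.dimension 4 base (carrier L)" using quartic unfolding quartic_extension_def .
  have alg: "(S.algebraic over base) x"
    using S.finite_dimension_imp_algebraic[OF base_subfield S.carrier_is_subring S.finite_dimensionI[OF dim] x] .
  note irr = L.IrrE[OF base_subfield x alg]
  have "S.dimension (length (S.Irr base x) - 1) base (carrier L)"
    using L.dimension_simple_extension[OF base_subfield x alg]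
      simple_extension_eq_generate_field[OF x alg] gen by simp
  then have "length (S.Irr base x) - 1 = 4"
    using S.dimension_is_inj[OF base_subfield _ dim] by blast
  then have len: "length (S.Irr base x) = 5" by simp
  then obtain c4 c3 c2 c1 c0 where c: "S.Irr base x = [c4, c3, c2, c1, c0]"
    by (auto simp: numeral_eq_Suc length_Suc_conv)
  have c4: "c4 = \<one>\<^bsub>L\<^esub>" using irr(3) c by simp
  have cb: "c3 \<in> base" "c2 \<in> base" "c1 \<in> base" "c0 \<in> base"
    using irr(1) unfolding univ_poly_carrier[symmetric] polynomial_def c by auto
  then have cc: "c3 \<in> carrier L" "c2 \<in> carrier L" "c1 \<in> carrier L" "c0 \<in> carrier L" "\<iota> a \<in> carrier L"
    using a by auto
  \<comment> \<open>the difference of the monic quartics \<open>Irr base x\<close> and \<open>X\<^sup>4 + a\<close>, which annihilates \<open>x\<close>\<close>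
  let ?r = "[c3, c2, c1, c0 \<ominus>\<^bsub>L\<^esub> \<iota> a]"
  have "c0 \<ominus>\<^bsub>L\<^esub> \<iota> a \<in> base"
    using cb(4) a subringE(5,7)[OF subfieldE(1)[OF base_subfield]] by (simp add: a_minus_def)
  then have set: "set ?r \<subseteq> base" using cb by simp
  have x3: "x [^]\<^bsub>L\<^esub> (3::nat) \<in> carrier L" "x [^]\<^bsub>L\<^esub> (2::nat) \<in> carrier L" "x [^]\<^bsub>L\<^esub> (4::nat) \<in> carrier L"
    using x by simp_all
  have "x [^]\<^bsub>L\<^esub> (4::nat) \<oplus>\<^bsub>L\<^esub> (c3 \<otimes>\<^bsub>L\<^esub> x [^]\<^bsub>L\<^esub> (3::nat) \<oplus>\<^bsub>L\<^esub> (c2 \<otimes>\<^bsub>L\<^esub> x [^]\<^bsub>L\<^esub> (2::nat)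
      \<oplus>\<^bsub>L\<^esub> (c1 \<otimes>\<^bsub>L\<^esub> x \<oplus>\<^bsub>L\<^esub> c0))) = \<zero>\<^bsub>L\<^esub>"
    using irr(4) x cc unfolding c c4 by (simp add: numeral_eq_Suc)
  then have "\<zero>\<^bsub>L\<^esub> = \<ominus>\<^bsub>L\<^esub> \<iota> a \<oplus>\<^bsub>L\<^esub> (c3 \<otimes>\<^bsub>L\<^esub> x [^]\<^bsub>L\<^esub> (3::nat) \<oplus>\<^bsub>L\<^esub> (c2 \<otimes>\<^bsub>L\<^esub> x [^]\<^bsub>L\<^esub> (2::nat)
      \<oplus>\<^bsub>L\<^esub> (c1 \<otimes>\<^bsub>L\<^esub> x \<oplus>\<^bsub>L\<^esub> c0)))" unfolding pow by simp
  also have "\<dots> = c3 \<otimes>\<^bsub>L\<^esub> x [^]\<^bsub>L\<^esub> (3::nat) \<oplus>\<^bsub>L\<^esub> (c2 \<otimes>\<^bsub>L\<^esub> x [^]\<^bsub>L\<^esub> (2::nat)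
      \<oplus>\<^bsub>L\<^esub> (c1 \<otimes>\<^bsub>L\<^esub> x \<oplus>\<^bsub>L\<^esub> (c0 \<ominus>\<^bsub>L\<^esub> \<iota> a)))"
    using cc x x3 by (simp add: a_minus_def S.add.m_ac)
  also have "\<dots> = S.eval ?r x"
    using cc x by (simp add: numeral_eq_Suc)
  \<comment> \<open>Leading entries of \<open>?r\<close> may vanish, so only its normalization is
    certain to be a polynomial.\<close>
  finally have "S.eval (S.normalize ?r) x = \<zero>\<^bsub>L\<^esub>"
    unfolding S.eval_normalize[OF subset_trans[OF set subfieldE(3)[OF base_subfield]] x] by (rule sym)
  moreover have "S.normalize ?r \<in> carrier (univ_poly L base)"
    using S.normalize_gives_polynomial[OF set] unfolding univ_poly_carrier .
  moreover have "length (S.normalize ?r) < length (S.Irr base x)"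
    using S.normalize_length_le[of ?r] len by simp
  ultimately have "S.normalize ?r = []"
    using low_degree_annihilator_zero[OF x alg] by blast
  \<comment> \<open>Normalization strips leading zeros only, so an empty result forces every entry
    to vanish.\<close>
  then have "c3 = \<zero>\<^bsub>L\<^esub>" "c2 = \<zero>\<^bsub>L\<^esub>" "c1 = \<zero>\<^bsub>L\<^esub>" "c0 \<ominus>\<^bsub>L\<^esub> \<iota> a = \<zero>\<^bsub>L\<^esub>"
    by (auto split: if_splits)
  then have "S.Irr base x = map \<iota> (quartic_binomial F a)"
    using c c4 cc by (simp add: quartic_binomial_def)
  moreover have "quartic_binomial F a \<in> carrier (univ_poly F (carrier F))"
    using a unfolding univ_poly_carrier[symmetric] polynomial_def quartic_binomial_def by simp
  ultimately show ?thesis unfolding is_min_poly_def using x alg by simp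
qed

text \<open>As c is invertible in F, x = c^-1 (cx) lies in the field generated by cx.\<close>

lemma radical_generator_scale:
  assumes rad: "radical_generator F L \<iota> x" and c: "c \<in> carrier F" "c \<noteq> \<zero>\<^bsub>F\<^esub>"
  shows "radical_generator F L \<iota> (\<iota> c \<otimes>\<^bsub>L\<^esub> x)"
proof -
  have x: "x \<in> carrier L" and gen: "generate_field L (insert x base) = carrier L"
    and x4: "x [^]\<^bsub>L\<^esub> (4::nat) \<in> base"
    using rad unfolding radical_generator_def by auto
  let ?y = "\<iota> c \<otimes>\<^bsub>L\<^esub> x"
  have y: "?y \<in> carrier L" using c x by simp
  have subs: "insert x base \<subseteq> carrier L" "insert ?y base \<subseteq> carrier L" using x y by auto
  note E = L.generate_field_is_subfield[OF subs(2)]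
  have inc: "insert ?y base \<subseteq> generate_field L (insert ?y base)"
    by (auto intro: generate_field.incl)
  have inv: "inv\<^bsub>F\<^esub> c \<in> carrier F" "inv\<^bsub>F\<^esub> c \<otimes>\<^bsub>F\<^esub> c = \<one>\<^bsub>F\<^esub>"
    using c F.field_Units by auto
  have "\<iota> (inv\<^bsub>F\<^esub> c) \<otimes>\<^bsub>L\<^esub> ?y = \<iota> (inv\<^bsub>F\<^esub> c \<otimes>\<^bsub>F\<^esub> c) \<otimes>\<^bsub>L\<^esub> x"
    using inv(1) c x by (simp add: S.m_assoc)
  then have "\<iota> (inv\<^bsub>F\<^esub> c) \<otimes>\<^bsub>L\<^esub> ?y = x" using inv(2) x by simp
  moreover have "\<iota> (inv\<^bsub>F\<^esub> c) \<otimes>\<^bsub>L\<^esub> ?y \<in> generate_field L (insert ?y base)"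
    using inc inv(1) generate_field.eng_mult[of "\<iota> (inv\<^bsub>F\<^esub> c)" L "insert ?y base" ?y] by blast
  ultimately have "insert x base \<subseteq> generate_field L (insert ?y base)" using inc by auto
  then have "carrier L \<subseteq> generate_field L (insert ?y base)"
    using L.generate_field_min_subfield1[OF subs(1) E] gen by blast
  then have "generate_field L (insert ?y base) = carrier L"
    using L.generate_field_incl[OF subs(2)] by blast
  moreover have "?y [^]\<^bsub>L\<^esub> (4::nat) \<in> base"
  proof -
    have "?y [^]\<^bsub>L\<^esub> (4::nat) = \<iota> (c [^]\<^bsub>F\<^esub> (4::nat)) \<otimes>\<^bsub>L\<^esub> x [^]\<^bsub>L\<^esub> (4::nat)"
      using c x by (simp add: S.nat_pow_distrib)
    then show ?thesis
      using x4 c(1) subringE(6)[OF subfieldE(1)[OF base_subfield], of "\<iota> (c [^]\<^bsub>F\<^esub> (4::nat))"]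
      by (metis R.nat_pow_closed imageI)
  qed
  ultimately show ?thesis using y unfolding radical_generator_def by simp
qed

subsection \<open>The Galois action\<close>

lemma Gal_carrierD:
  assumes "s \<in> carrier (Gal F L \<iota>)"
  shows "s \<in> Bij (carrier L)" "s \<in> ring_hom L L" "\<And>x. x \<in> carrier F \<Longrightarrow> s (\<iota> x) = \<iota> x"
  using assms unfolding Gal_def by auto

lemma Gal_mult:
  assumes "s \<in> carrier (Gal F L \<iota>)" "t \<in> carrier (Gal F L \<iota>)"
  shows "s \<otimes>\<^bsub>Gal F L \<iota>\<^esub> t = compose (carrier L) s t"
  using Gal_carrierD(1)[OF assms(1)] Gal_carrierD(1)[OF assms(2)]
  unfolding Gal_def BijGroup_def by simp

lemma Gal_compose_closed:
  assumes s: "s \<in> carrier (Gal F L \<iota>)" and t: "t \<in> carrier (Gal F L \<iota>)"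
  shows "compose (carrier L) s t \<in> carrier (Gal F L \<iota>)"
proof -
  note S = Gal_carrierD[OF s] and T = Gal_carrierD[OF t]
  have "compose (carrier L) s t \<in> ring_hom L L"
    using ring_hom_memE[OF S(2)] ring_hom_memE[OF T(2)]
    by (intro ring_hom_memI) (auto simp: compose_def)
  then show ?thesis
    using compose_Bij[OF S(1) T(1)] S(3) T(3) unfolding Gal_def by (simp add: compose_def)
qed

text \<open>Elements of \<open>Bij\<close> are extensional, so the identity appears restricted to
  the carrier.\<close>

lemma Gal_id_closed: "(\<lambda>x\<in>carrier L. x) \<in> carrier (Gal F L \<iota>)"
proof -
  have "(\<lambda>x\<in>carrier L. x) \<in> ring_hom L L" by (rule ring_hom_memI) auto
  then show ?thesis using id_Bij unfolding Gal_def by auto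
qed

text \<open>Exponent 2 and order 4 are carried back from \<open>?V\<close> along the
  isomorphism.\<close>

lemma klein_action_Gal:
  assumes "elementary_abelian_quartic F L \<iota>"
  shows "klein_action L (carrier (Gal F L \<iota>))"
proof -
  let ?G = "Gal F L \<iota>" and ?V = "integer_mod_group 2 \<times>\<times> integer_mod_group 2"
  let ?e = "\<lambda>x\<in>carrier L. x"
  have iso: "?G \<cong> ?V" using assms unfolding elementary_abelian_quartic_def by simp
  then obtain f where f: "f \<in> hom ?G ?V" "inj_on f (carrier ?G)"
    unfolding is_iso_def iso_def bij_betw_def by auto
  have zero: "f (s \<otimes>\<^bsub>?G\<^esub> s) = (0, 0)" if "s \<in> carrier ?G" for s
  proof -
    have "f s \<in> carrier ?V" using f(1) that unfolding hom_def by auto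
    then have "f s \<otimes>\<^bsub>?V\<^esub> f s = (0, 0)"
      by (auto simp: mult_DirProd' carrier_integer_mod_group)
    then show ?thesis using Group.hom_mult[OF f(1) that that] by simp
  qed
  \<comment> \<open>As \<open>?e\<close> is its own square, \<open>zero\<close> gives f ?e = (0, 0).
    Every square thus has the same image as \<open>?e\<close>, and injectivity of f yields
    \<open>sq\<close>.\<close>
  have idid: "?e \<otimes>\<^bsub>?G\<^esub> ?e = ?e"
    unfolding Gal_mult[OF Gal_id_closed Gal_id_closed] by (auto simp: compose_def)
  have sq: "s \<otimes>\<^bsub>?G\<^esub> s = ?e" if s: "s \<in> carrier ?G" for s
  proof -
    have "f (s \<otimes>\<^bsub>?G\<^esub> s) = f ?e" using zero[OF s] zero[OF Gal_id_closed] idid by simp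
    moreover have "s \<otimes>\<^bsub>?G\<^esub> s \<in> carrier ?G"
      unfolding Gal_mult[OF s s] using Gal_compose_closed[OF s s] .
    ultimately show ?thesis using inj_onD[OF f(2)] Gal_id_closed by blast
  qed
  show ?thesis
  proof (intro klein_action.intro klein_action_axioms.intro)
    show "field L" by (rule L.field_axioms)
  next
    fix s assume "s \<in> carrier ?G"
    then show "s \<in> ring_hom L L" by (rule Gal_carrierD)
  next
    fix s t assume "s \<in> carrier ?G" "t \<in> carrier ?G"
    then show "\<exists>r\<in>carrier ?G. \<forall>x\<in>carrier L. r x = s (t x)"
      using Gal_compose_closed[of s t]
      by (intro bexI[of _ "compose (carrier L) s t"]) (simp_all add: compose_def)
  next
    fix s x assume s: "s \<in> carrier ?G" and x: "x \<in> carrier L"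
    have "compose (carrier L) s s x = ?e x" using sq[OF s] Gal_mult[OF s s] by simp
    then show "s (s x) = x" using x by (simp add: compose_def)
  next
    have "card (carrier ?V) = 4" by (simp add: carrier_integer_mod_group card_cartesian_product)
    then show "card (carrier ?G) = 4" using iso_same_card[OF iso] by simp
  qed
qed

lemma Gal_fixed:
  assumes "elementary_abelian_quartic F L \<iota>" "x \<in> carrier L"
    and "\<forall>s\<in>carrier (Gal F L \<iota>). s x = x"
  shows "x \<in> base"
  using assms unfolding elementary_abelian_quartic_def galois_extension_def by blast

text \<open>Agreement at x and on the base spreads through the field operations to all of L;
  extensionality then turns agreement on the carrier into equality of functions.\<close>

lemma Gal_eqI:
  assumes s: "s \<in> carrier (Gal F L \<iota>)" and t: "t \<in> carrier (Gal F L \<iota>)"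
    and x: "x \<in> carrier L" "generate_field L (insert x base) = carrier L" and eq: "s x = t x"
  shows "s = t"
proof -
  note S = Gal_carrierD[OF s] and T = Gal_carrierD[OF t]
  interpret s: ring_hom_cring L L s by unfold_locales (rule S)
  interpret t: ring_hom_cring L L t by unfold_locales (rule T)
  have "y \<in> carrier L \<and> s y = t y" if "y \<in> generate_field L (insert x base)" for y
    using that
  proof (induction rule: generate_field.induct)
    case (incl h)
    then show ?case using eq x S(3) T(3) by auto
  next
    case (m_inv h)
    have h: "h \<in> carrier L" "inv\<^bsub>L\<^esub> h \<in> carrier L" "h \<otimes>\<^bsub>L\<^esub> inv\<^bsub>L\<^esub> h = \<one>\<^bsub>L\<^esub>"
      using m_inv L.field_Units by auto
    have "s h \<otimes>\<^bsub>L\<^esub> s (inv\<^bsub>L\<^esub> h) = \<one>\<^bsub>L\<^esub>" "t h \<otimes>\<^bsub>L\<^esub> t (inv\<^bsub>L\<^esub> h) = \<one>\<^bsub>L\<^esub>"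
      using s.hom_mult[OF h(1,2)] t.hom_mult[OF h(1,2)] unfolding h(3) s.hom_one t.hom_one by (metis, metis)
    then have "inv\<^bsub>L\<^esub> (s h) = s (inv\<^bsub>L\<^esub> h)" "inv\<^bsub>L\<^esub> (t h) = t (inv\<^bsub>L\<^esub> h)"
      using h by (auto intro: S.comm_inv_char)
    then show ?case using m_inv h by metis
  qed auto
  then have "\<And>y. y \<in> carrier L \<Longrightarrow> s y = t y" using x(2) by blast
  then show ?thesis
    using extensionalityI[OF Bij_imp_extensional[OF S(1)] Bij_imp_extensional[OF T(1)]] by blast
qed

text \<open>The bridge to the abstract action: generation gives injectivity by
  \<open>Gal_eqI\<close>, and the fourth power lies in the base, which automorphisms fix.\<close>

lemma kummer_generator_of_radical_generator:
  assumes ea: "elementary_abelian_quartic F L \<iota>" and rad: "radical_generator F L \<iota> x"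
  shows "klein_action.kummer_generator L (carrier (Gal F L \<iota>)) x"
proof -
  interpret K: klein_action L "carrier (Gal F L \<iota>)" by (rule klein_action_Gal[OF ea])
  have x: "x \<in> carrier L" "generate_field L (insert x base) = carrier L" "x [^]\<^bsub>L\<^esub> (4::nat) \<in> base"
    using rad unfolding radical_generator_def by auto
  have "inj_on (\<lambda>s. s x) (carrier (Gal F L \<iota>))"
    by (rule inj_onI) (rule Gal_eqI[OF _ _ x(1,2)])
  moreover have "s (x [^]\<^bsub>L\<^esub> (4::nat)) = x [^]\<^bsub>L\<^esub> (4::nat)" if "s \<in> carrier (Gal F L \<iota>)" for s
    using Gal_carrierD(3)[OF that] x(3) by auto
  ultimately show ?thesis unfolding K.kummer_generator_def using x(1) by blast
qed

lemma radical_generator_nonzero: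
  assumes "elementary_abelian_quartic F L \<iota>" "radical_generator F L \<iota> x"
  shows "x \<noteq> \<zero>\<^bsub>L\<^esub>"
  using klein_action.kummer_generator_nonzero[OF klein_action_Gal[OF assms(1)]
      kummer_generator_of_radical_generator[OF assms]] .

lemma radicand_nonzero:
  assumes "elementary_abelian_quartic F L \<iota>" "radical_generator F L \<iota> x"
    and "a \<in> carrier F" "x [^]\<^bsub>L\<^esub> (4::nat) = \<ominus>\<^bsub>L\<^esub> \<iota> a"
  shows "a \<noteq> \<zero>\<^bsub>F\<^esub>"
proof
  assume "a = \<zero>\<^bsub>F\<^esub>"
  then have "x [^]\<^bsub>L\<^esub> (4::nat) = \<zero>\<^bsub>L\<^esub>" using assms(4) by simp
  moreover have "x \<in> carrier L" using assms(2) unfolding radical_generator_def by simp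
  ultimately show False
    using radical_generator_nonzero[OF assms(1,2)] by (simp add: S.nat_pow_4 L.integral_iff)
qed

text \<open>The invariant square root of -x^4 descends to F, because the fixed field of the Galois
  group is the base.\<close>

lemma radicand_is_square:
  assumes ea: "elementary_abelian_quartic F L \<iota>" and rad: "radical_generator F L \<iota> x"
    and a: "a \<in> carrier F" and pow: "x [^]\<^bsub>L\<^esub> (4::nat) = \<ominus>\<^bsub>L\<^esub> \<iota> a"
  obtains b where "b \<in> carrier F" "a = b \<otimes>\<^bsub>F\<^esub> b"
proof -
  interpret K: klein_action L "carrier (Gal F L \<iota>)" by (rule klein_action_Gal[OF ea])
  obtain y where y: "y \<in> carrier L" "\<forall>s\<in>carrier (Gal F L \<iota>). s y = y"
    "\<ominus>\<^bsub>L\<^esub> (x [^]\<^bsub>L\<^esub> (4::nat)) = y \<otimes>\<^bsub>L\<^esub> y"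
    using K.minus_kummer_power_is_fixed_square[OF kummer_generator_of_radical_generator[OF ea rad]] by blast
  obtain b where b: "b \<in> carrier F" "y = \<iota> b" using Gal_fixed[OF ea y(1,2)] by blast
  have "\<iota> a = \<iota> (b \<otimes>\<^bsub>F\<^esub> b)" using y(3) pow a b by simp
  then have "a = b \<otimes>\<^bsub>F\<^esub> b" using embedding_eq_iff[OF a, of "b \<otimes>\<^bsub>F\<^esub> b"] b(1) by simp
  then show thesis using that b(1) by blast
qed

text \<open>The invariant factor between the fourth powers lies in the base; both radicands enter
  with the sign -1, which cancels.\<close>

lemma radicands_ratio:
  assumes ea: "elementary_abelian_quartic F L \<iota>"
    and x: "radical_generator F L \<iota> x" "a \<in> carrier F" "x [^]\<^bsub>L\<^esub> (4::nat) = \<ominus>\<^bsub>L\<^esub> \<iota> a"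
    and y: "radical_generator F L \<iota> y" "b \<in> carrier F" "y [^]\<^bsub>L\<^esub> (4::nat) = \<ominus>\<^bsub>L\<^esub> \<iota> b"
  obtains c where "c \<in> carrier F" "b = c [^]\<^bsub>F\<^esub> (4::nat) \<otimes>\<^bsub>F\<^esub> a"
proof -
  interpret K: klein_action L "carrier (Gal F L \<iota>)" by (rule klein_action_Gal[OF ea])
  obtain z where z: "z \<in> carrier L" "\<forall>s\<in>carrier (Gal F L \<iota>). s z = z"
    "y [^]\<^bsub>L\<^esub> (4::nat) = z [^]\<^bsub>L\<^esub> (4::nat) \<otimes>\<^bsub>L\<^esub> x [^]\<^bsub>L\<^esub> (4::nat)"
    using K.kummer_generators_ratio[OF kummer_generator_of_radical_generator[OF ea x(1)]
        kummer_generator_of_radical_generator[OF ea y(1)]] by blast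
  obtain c where c: "c \<in> carrier F" "z = \<iota> c" using Gal_fixed[OF ea z(1,2)] by blast
  have "\<ominus>\<^bsub>L\<^esub> \<iota> b = \<iota> (c [^]\<^bsub>F\<^esub> (4::nat)) \<otimes>\<^bsub>L\<^esub> \<ominus>\<^bsub>L\<^esub> \<iota> a"
    using z(3) unfolding x(3) y(3) c(2) using c(1) by simp
  then have "\<ominus>\<^bsub>L\<^esub> \<iota> b = \<ominus>\<^bsub>L\<^esub> \<iota> (c [^]\<^bsub>F\<^esub> (4::nat) \<otimes>\<^bsub>F\<^esub> a)"
    using c(1) x(2) by (simp add: S.r_minus)
  then have "b = c [^]\<^bsub>F\<^esub> (4::nat) \<otimes>\<^bsub>F\<^esub> a"
    using minus_embedding_eq_iff[OF y(2), of "c [^]\<^bsub>F\<^esub> (4::nat) \<otimes>\<^bsub>F\<^esub> a"] c(1) x(2) by simp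
  then show thesis using that c(1) by blast
qed

end

section \<open>Transport of radical generators along isomorphisms\<close>

lemma radical_generator_iso:
  assumes "field_extension F L \<iota>" "field_extension F L' \<iota>'"
    and \<phi>: "\<phi> \<in> ring_iso L L'" "\<And>c. c \<in> carrier F \<Longrightarrow> \<phi> (\<iota> c) = \<iota>' c"
    and x: "radical_generator F L \<iota> x"
  shows "radical_generator F L' \<iota>' (\<phi> x)" "\<phi> (x [^]\<^bsub>L\<^esub> (4::nat)) = \<phi> x [^]\<^bsub>L'\<^esub> (4::nat)"
proof -
  interpret E: field_extension F L \<iota> by fact
  interpret E': field_extension F L' \<iota>' by fact
  interpret \<phi>: ring_hom_cring L L' \<phi> using \<phi>(1) by unfold_locales (simp add: ring_iso_def)
  have D: "x \<in> carrier L" "generate_field L (insert x E.base) = carrier L" "x [^]\<^bsub>L\<^esub> (4::nat) \<in> E.base"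
    using x unfolding radical_generator_def by auto
  show pow: "\<phi> (x [^]\<^bsub>L\<^esub> (4::nat)) = \<phi> x [^]\<^bsub>L'\<^esub> (4::nat)"
    using D(1) by (rule \<phi>.ring.hom_nat_pow)
  let ?H = "generate_field L' (insert (\<phi> x) E'.base)"
  \<comment> \<open>Induction over the generated field places every image in \<open>?H\<close>;
    surjectivity of \<phi> then makes \<open>?H\<close> the whole field.\<close>
  have "y \<in> carrier L \<and> \<phi> y \<in> ?H" if "y \<in> generate_field L (insert x E.base)" for y
    using that
  proof (induction rule: generate_field.induct)
    case one
    then show ?case by (simp add: generate_field.one)
  next
    case (incl h)
    then show ?case using D(1) \<phi>(2) by (auto intro!: generate_field.incl)
  next
    case (a_inv h)
    then show ?case by (simp add: generate_field.a_inv)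
  next
    case (m_inv h)
    have h: "h \<in> carrier L" "inv\<^bsub>L\<^esub> h \<in> carrier L" "h \<otimes>\<^bsub>L\<^esub> inv\<^bsub>L\<^esub> h = \<one>\<^bsub>L\<^esub>"
      using m_inv E.L.field_Units by auto
    have m: "\<phi> h \<otimes>\<^bsub>L'\<^esub> \<phi> (inv\<^bsub>L\<^esub> h) = \<one>\<^bsub>L'\<^esub>" using \<phi>.hom_mult[OF h(1,2)] h(3) by simp
    have "inv\<^bsub>L'\<^esub> (\<phi> h) = \<phi> (inv\<^bsub>L\<^esub> h)" using h m by (intro E'.S.comm_inv_char) auto
    moreover have "\<phi> h \<noteq> \<zero>\<^bsub>L'\<^esub>" using m h by auto
    ultimately show ?case using m_inv h generate_field.m_inv[of "\<phi> h" L'] by metis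
  qed (simp_all add: generate_field.eng_add generate_field.eng_mult)
  then have "\<phi> ` carrier L \<subseteq> ?H" using D(2) by blast
  moreover have "\<phi> ` carrier L = carrier L'" using \<phi>(1) by (simp add: ring_iso_def bij_betw_def)
  moreover have "?H \<subseteq> carrier L'"
    using D(1) by (intro E'.L.generate_field_incl) auto
  moreover have "\<phi> x [^]\<^bsub>L'\<^esub> (4::nat) \<in> E'.base"
  proof -
    obtain c where "c \<in> carrier F" "x [^]\<^bsub>L\<^esub> (4::nat) = \<iota> c" using D(3) by blast
    then have "\<phi> x [^]\<^bsub>L'\<^esub> (4::nat) = \<iota>' c" using pow \<phi>(2) by simp
    then show ?thesis using \<open>c \<in> carrier F\<close> by simp
  qed
  ultimately show "radical_generator F L' \<iota>' (\<phi> x)"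
    unfolding radical_generator_def using D(1) by auto
qed

section \<open>Fourth-power ratios in a field\<close>

context field
begin

text \<open>If c were 0, so would be b; hence c is invertible and the relation can be
  reversed.\<close>

lemma fourth_power_ratio_sym:
  assumes "a \<in> carrier R" "b \<in> carrier R" "c \<in> carrier R" "b \<noteq> \<zero>"
    and "b = c [^] (4::nat) \<otimes> a"
  shows "c \<noteq> \<zero>" "a = (inv c) [^] (4::nat) \<otimes> b"
proof -
  show c: "c \<noteq> \<zero>" using assms by (auto simp: nat_pow_4)
  have inv: "inv c \<in> carrier R" "inv c \<otimes> c = \<one>" using c assms field_Units by auto
  have "(inv c) [^] (4::nat) \<otimes> b = (inv c \<otimes> c) [^] (4::nat) \<otimes> a"
    unfolding assms(5) using inv(1) assms(1,3) by (simp add: nat_pow_distrib m_assoc)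
  then show "a = (inv c) [^] (4::nat) \<otimes> b" using inv assms(1) by simp
qed

text \<open>For j = 3, a^3 = a^2 a = b^4 a, so c = db; for j = 1, c = d.\<close>

lemma odd_power_of_square:
  assumes "a \<in> carrier R" "b \<in> carrier R" "d \<in> carrier R" "a = b \<otimes> b" "j \<in> {1, 3::nat}"
  obtains c where "c \<in> carrier R" "d [^] (4::nat) \<otimes> a [^] j = c [^] (4::nat) \<otimes> a"
proof (cases "j = 1")
  case True
  then show thesis using that[of d] assms by simp
next
  case False
  then have j: "j = 3" using assms by simp
  have "a [^] j = (a \<otimes> a) \<otimes> a" using assms(1) by (simp add: j numeral_eq_Suc)
  also have "a \<otimes> a = b [^] (4::nat)" using assms by (simp add: nat_pow_4)
  finally have "d [^] (4::nat) \<otimes> a [^] j = (d \<otimes> b) [^] (4::nat) \<otimes> a"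
    using assms(1-3) by (simp add: nat_pow_distrib m_assoc)
  then show thesis using that assms(2,3) by blast
qed

end

section \<open>The equivalence\<close>

theorem corollary3p6:
  fixes F :: "('f, 'r) ring_scheme"
    and L :: "('l, 's) ring_scheme" and \<iota> :: "'f \<Rightarrow> 'l" and \<alpha> :: 'l
    and L' :: "('m, 't) ring_scheme" and \<iota>' :: "'f \<Rightarrow> 'm" and \<alpha>' :: 'm
    and a a' :: 'f
  assumes "field F" and "ring_char F \<noteq> 2"
    and "field_extension F L \<iota>" and "elementary_abelian_quartic F L \<iota>" and "radical_quartic F L \<iota>"
    and "field_extension F L' \<iota>'" and "elementary_abelian_quartic F L' \<iota>'" and "radical_quartic F L' \<iota>'"
    and "a \<in> carrier F" and "a' \<in> carrier F"
    and "radical_generator F L \<iota> \<alpha>" and "is_min_poly F L \<iota> \<alpha> (quartic_binomial F a)"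
    and "radical_generator F L' \<iota>' \<alpha>'" and "is_min_poly F L' \<iota>' \<alpha>' (quartic_binomial F a')"
  shows
    "(extension_iso F L \<iota> L' \<iota>' \<longleftrightarrow>
        (\<exists>j\<in>{1, 3::nat}. \<exists>d\<in>carrier F. a' = d [^]\<^bsub>F\<^esub> (4::nat) \<otimes>\<^bsub>F\<^esub> a [^]\<^bsub>F\<^esub> j)) \<and>
     (extension_iso F L \<iota> L' \<iota>' \<longleftrightarrow>
        (\<exists>c\<in>carrier F. a' = c [^]\<^bsub>F\<^esub> (4::nat) \<otimes>\<^bsub>F\<^esub> a)) \<and>
     (extension_iso F L \<iota> L' \<iota>' \<longleftrightarrow>
        (\<exists>c\<in>carrier F. radical_generator F L' \<iota>' (\<iota>' c \<otimes>\<^bsub>L'\<^esub> \<alpha>') \<and>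
           is_min_poly F L' \<iota>' (\<iota>' c \<otimes>\<^bsub>L'\<^esub> \<alpha>') (quartic_binomial F a))) \<and>
     (extension_iso F L \<iota> L' \<iota>' \<longleftrightarrow>
        (\<exists>j\<in>{1, 3::nat}. \<exists>d\<in>carrier F.
           radical_generator F L' \<iota>' (\<iota>' d \<otimes>\<^bsub>L'\<^esub> \<alpha>' [^]\<^bsub>L'\<^esub> j) \<and>
           is_min_poly F L' \<iota>' (\<iota>' d \<otimes>\<^bsub>L'\<^esub> \<alpha>' [^]\<^bsub>L'\<^esub> j) (quartic_binomial F a)))"
proof -
  interpret E: field_extension F L \<iota> by fact
  interpret E': field_extension F L' \<iota>' by fact
  note ea = assms(4) and ea' = assms(7) and a = assms(9) and a' = assms(10)
    and rad = assms(11) and rad' = assms(13)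
  have quartic': "quartic_extension F L' \<iota>'"
    using ea' unfolding elementary_abelian_quartic_def by simp
  note pow = E.fourth_power_of_min_poly[OF a assms(12)]
    and pow' = E'.fourth_power_of_min_poly[OF a' assms(14)]
  note nz = E.radicand_nonzero[OF ea rad a pow] and nz' = E'.radicand_nonzero[OF ea' rad' a' pow']
  have \<alpha>': "\<alpha>' \<in> carrier L'" using rad' unfolding radical_generator_def by simp
  let ?iso = "extension_iso F L \<iota> L' \<iota>'"
  let ?odd = "\<exists>j\<in>{1, 3::nat}. \<exists>d\<in>carrier F. a' = d [^]\<^bsub>F\<^esub> (4::nat) \<otimes>\<^bsub>F\<^esub> a [^]\<^bsub>F\<^esub> j"
  let ?ratio = "\<exists>c\<in>carrier F. a' = c [^]\<^bsub>F\<^esub> (4::nat) \<otimes>\<^bsub>F\<^esub> a"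
  let ?gen = "\<lambda>x. radical_generator F L' \<iota>' x \<and> is_min_poly F L' \<iota>' x (quartic_binomial F a)"
  let ?scaled = "\<exists>c\<in>carrier F. ?gen (\<iota>' c \<otimes>\<^bsub>L'\<^esub> \<alpha>')"
  let ?scaled_odd = "\<exists>j\<in>{1, 3::nat}. \<exists>d\<in>carrier F. ?gen (\<iota>' d \<otimes>\<^bsub>L'\<^esub> \<alpha>' [^]\<^bsub>L'\<^esub> j)"
  have iso_ratio: ?ratio if ?iso
  proof -
    obtain \<phi> where \<phi>: "\<phi> \<in> ring_iso L L'" "\<And>c. c \<in> carrier F \<Longrightarrow> \<phi> (\<iota> c) = \<iota>' c"
      using \<open>?iso\<close> unfolding extension_iso_def by blast
    interpret \<phi>: ring_hom_cring L L' \<phi> using \<phi>(1) by unfold_locales (simp add: ring_iso_def)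
    \<comment> \<open>Now \<phi> \<alpha> is a radical generator of L' with radicand a, so it can be
      compared with \<alpha>' inside one field.\<close>
    note R = radical_generator_iso[OF assms(3,6) \<phi> rad]
    have "\<phi> \<alpha> [^]\<^bsub>L'\<^esub> (4::nat) = \<ominus>\<^bsub>L'\<^esub> \<iota>' a"
      using R(2) \<phi>(2)[OF a] a unfolding pow by simp
    from E'.radicands_ratio[OF ea' R(1) a this rad' a' pow'] show ?thesis by blast
  qed
  have odd_ratio: ?ratio if ?odd
  proof -
    obtain j d where j: "j \<in> {1, 3::nat}" and d: "d \<in> carrier F"
      and eq: "a' = d [^]\<^bsub>F\<^esub> (4::nat) \<otimes>\<^bsub>F\<^esub> a [^]\<^bsub>F\<^esub> j" using \<open>?odd\<close> by blast
    obtain b where b: "b \<in> carrier F" "a = b \<otimes>\<^bsub>F\<^esub> b"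
      using E.radicand_is_square[OF ea rad a pow] .
    from E.F.odd_power_of_square[OF a b(1) d b(2) j] show ?thesis using eq by metis
  qed
  have ratio_scaled: ?scaled if ?ratio
  proof -
    obtain c where c: "c \<in> carrier F" "a' = c [^]\<^bsub>F\<^esub> (4::nat) \<otimes>\<^bsub>F\<^esub> a" using \<open>?ratio\<close> by blast
    note S = E.F.fourth_power_ratio_sym[OF a a' c(1) nz' c(2)]
    \<comment> \<open>Dividing \<alpha>' by c turns its fourth power -a' into -a.\<close>
    define e where "e = inv\<^bsub>F\<^esub> c"
    have e: "e \<in> carrier F" "a = e [^]\<^bsub>F\<^esub> (4::nat) \<otimes>\<^bsub>F\<^esub> a'"
      using S c(1) E.F.field_Units unfolding e_def by auto
    have "e \<noteq> \<zero>\<^bsub>F\<^esub>" using E.F.fourth_power_ratio_sym(1)[OF a' a e(1) nz e(2)] .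
    then have gen: "radical_generator F L' \<iota>' (\<iota>' e \<otimes>\<^bsub>L'\<^esub> \<alpha>')"
      using E'.radical_generator_scale[OF rad' e(1)] by blast
    have "(\<iota>' e \<otimes>\<^bsub>L'\<^esub> \<alpha>') [^]\<^bsub>L'\<^esub> (4::nat) = \<iota>' (e [^]\<^bsub>F\<^esub> (4::nat)) \<otimes>\<^bsub>L'\<^esub> \<ominus>\<^bsub>L'\<^esub> \<iota>' a'"
      using e(1) \<alpha>' pow' by (simp add: E'.S.nat_pow_distrib)
    also have "\<dots> = \<ominus>\<^bsub>L'\<^esub> \<iota>' (e [^]\<^bsub>F\<^esub> (4::nat) \<otimes>\<^bsub>F\<^esub> a')"
      using e(1) a' by (simp add: E'.S.r_minus)
    finally have "(\<iota>' e \<otimes>\<^bsub>L'\<^esub> \<alpha>') [^]\<^bsub>L'\<^esub> (4::nat) = \<ominus>\<^bsub>L'\<^esub> \<iota>' a"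
      using e(2) by simp
    then show ?thesis
      using E'.min_poly_of_radical_generator[OF quartic' gen a] gen e(1) by blast
  qed
  have scaled_iso: ?iso if ?scaled
  proof -
    obtain x where "?gen x" using \<open>?scaled\<close> by blast
    then show ?thesis
      using extension_iso_of_common_min_poly[OF assms(3,6,12) _ _, of x] rad
      unfolding radical_generator_def by blast
  qed
  have scaled_scaled_odd: ?scaled_odd if ?scaled
    using that \<alpha>' by auto
  have scaled_odd_ratio: ?ratio if ?scaled_odd
  proof -
    obtain j d where j: "j \<in> {1, 3::nat}" and d: "d \<in> carrier F"
      and min: "is_min_poly F L' \<iota>' (\<iota>' d \<otimes>\<^bsub>L'\<^esub> \<alpha>' [^]\<^bsub>L'\<^esub> j) (quartic_binomial F a)"
      using \<open>?scaled_odd\<close> by blast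
    have "(\<alpha>' [^]\<^bsub>L'\<^esub> j) [^]\<^bsub>L'\<^esub> (4::nat) = (\<alpha>' [^]\<^bsub>L'\<^esub> (4::nat)) [^]\<^bsub>L'\<^esub> j"
      using \<alpha>' by (simp add: E'.S.nat_pow_pow mult.commute)
    \<comment> \<open>Since j is odd, the j-th power keeps the sign of -a'.\<close>
    also have "\<dots> = \<ominus>\<^bsub>L'\<^esub> \<iota>' (a' [^]\<^bsub>F\<^esub> j)"
      using j a' unfolding pow'
      by (auto simp: numeral_eq_Suc E'.S.l_minus E'.S.r_minus)
    finally have "(\<iota>' d \<otimes>\<^bsub>L'\<^esub> \<alpha>' [^]\<^bsub>L'\<^esub> j) [^]\<^bsub>L'\<^esub> (4::nat)
        = \<iota>' (d [^]\<^bsub>F\<^esub> (4::nat)) \<otimes>\<^bsub>L'\<^esub> \<ominus>\<^bsub>L'\<^esub> \<iota>' (a' [^]\<^bsub>F\<^esub> j)"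
      using d \<alpha>' by (simp add: E'.S.nat_pow_distrib)
    also have "\<dots> = \<ominus>\<^bsub>L'\<^esub> \<iota>' (d [^]\<^bsub>F\<^esub> (4::nat) \<otimes>\<^bsub>F\<^esub> a' [^]\<^bsub>F\<^esub> j)"
      using d a' by (simp add: E'.S.r_minus)
    finally have "\<ominus>\<^bsub>L'\<^esub> \<iota>' a = \<ominus>\<^bsub>L'\<^esub> \<iota>' (d [^]\<^bsub>F\<^esub> (4::nat) \<otimes>\<^bsub>F\<^esub> a' [^]\<^bsub>F\<^esub> j)"
      using E'.fourth_power_of_min_poly[OF a min] by simp
    then have eq: "a = d [^]\<^bsub>F\<^esub> (4::nat) \<otimes>\<^bsub>F\<^esub> a' [^]\<^bsub>F\<^esub> j"
      using E'.minus_embedding_eq_iff[OF a, of "d [^]\<^bsub>F\<^esub> (4::nat) \<otimes>\<^bsub>F\<^esub> a' [^]\<^bsub>F\<^esub> j"] d a' by simp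
    \<comment> \<open>Here the odd power is one of a', so it is the squareness of a', read off from
      L', that reduces it to a fourth-power ratio.\<close>
    obtain b where b: "b \<in> carrier F" "a' = b \<otimes>\<^bsub>F\<^esub> b"
      using E'.radicand_is_square[OF ea' rad' a' pow'] .
    obtain c where c: "c \<in> carrier F" "a = c [^]\<^bsub>F\<^esub> (4::nat) \<otimes>\<^bsub>F\<^esub> a'"
      using E.F.odd_power_of_square[OF a' b(1) d b(2) j] eq by metis
    note S = E.F.fourth_power_ratio_sym[OF a' a c(1) nz c(2)]
    have "inv\<^bsub>F\<^esub> c \<in> carrier F" using S(1) c(1) E.F.field_Units by auto
    then show ?thesis using S(2) by blast
  qed
  have ratio_odd: ?odd if ?ratio
    using that a by auto
  \<comment> \<open>The implications form the cycle \<open>?iso\<close>, \<open>?ratio\<close>,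
    \<open>?scaled\<close>, \<open>?iso\<close>; \<open>?odd\<close> is equivalent to
    \<open>?ratio\<close>, and \<open>?scaled_odd\<close> lies between \<open>?scaled\<close> and
    \<open>?ratio\<close>.\<close>
  show ?thesis
    using iso_ratio odd_ratio ratio_scaled scaled_iso scaled_scaled_odd scaled_odd_ratio ratio_odd
    by argo
qed

end
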